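(* Let $p\in[1,\infty]$, $p^{-1}+q^{-1}=1$, and let $\gamma\ge 0$. Assume that the finite set of probe functions $\Psi_{I_N}=\{\psi_{ij}: i,j\in I_N,\ i\ne j\}$ is $(\gamma,p)$-good with respect to $\mathcal{G}_{I_N}=\{f_i-f_j: i,j\in I_N,\ i\neq j\}$, where $\psi_{ij}$ is the representer of $f_i-f_j$. Define $i_*:=\arg\min_{i\in I_N}\|f-f_i\|_p$ and $$\Psi^*_{I_N}:=\{\psi_{i_* i}: i\in I_N,\ i\ne i_*\}\subseteq \Psi_{I_N}.$$ Let $\delta\in(0,1)$ be fixed and let $$\varkappa=\varkappa(\delta,\Psi_{I_N}):=\min\Big\{\varkappa>0 : \mathbb{P}\Big[\max_{\psi\in\Psi_{I_N}}\frac{|Z(\psi)|}{\|\psi\|_2}\ge\varkappa\Big]\le\delta\Big\}.$$ Let $\hat f=f_{\hat i}$, where $$\hat i:=\arg\min_{i\in I_N}\hat M_i,\qquad \hat M_i:=\max_{\psi\in\Psi_{I_N}}\Big\{\frac{1}{\|\psi\|_q}\big[|\Delta_i(\psi)|-\varepsilon\varkappa\|\psi\|_2\big]\Big\}.$$ Then $$\mathcal{R}_p[\hat f;f]\le\Big(2\max_{\psi\in\Psi^*_{I_N}}\|\psi\|_q+1\Big)\min_{i\in I_N}\|f-f_i\|_p+2\varkappa\varepsilon\max_{\psi\in\Psi^*_{I_N}}\|\psi\|_2+\gamma+\Big[\|f\|_p+\max_{i\in I_N}\|f_i\|_p\Big]\delta .$$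
   Context: Model: $\mathcal{D}_0=[0,1]^d$, $\varepsilon\in(0,1)$, and one observes $\mathcal{Y}_\varepsilon$ in the Gaussian white noise model $Y_\varepsilon(dt)=f(t)\,dt+\varepsilon W(dt)$, $t\in\mathcal{D}_0$, with $f$ an unknown real function and $W$ the standard Wiener process in $\mathbb{R}^d$. Thus for a probe function $\psi\in\mathbb{L}_2(\mathcal{D}_0)$ one observes $\int\psi(t)Y_\varepsilon(dt)=\int\psi f\,dt+\varepsilon Z(\psi)$, where $Z(\psi)=\int\psi(t)W(dt)$ is the zero-mean Gaussian process, linear in $\psi$, with $\mathbb{E}[Z(\psi)Z(\phi)]=\int\psi\phi\,dt$. $\|\cdot\|_p$ is the $\mathbb{L}_p$-norm on $\mathcal{D}_0$ (Lebesgue measure); the risk of an estimator $\tilde f$ is $\mathcal{R}_p[\tilde f;f]:=\mathbb{E}_f\|\tilde f-f\|_p$, with $\mathbb{E}_f$ the expectation under the model with signal $f$. Family: $I_N=\{1,\dots,N\}$, $N\ge2$, and $f_1,\dots,f_N$ are distinct fixed (nonrandom) functions on $\mathcal{D}_0$. Good sets: a set $\Psi$ of functions on $\mathcal{D}_0$ is $(\gamma,p)$-good with respect to a set $\mathcal{G}$ of functions if for every $g\in\mathcal{G}$ there is $\psi_g\in\Psi$ (the representer of $g$) with $\big|\int\psi_g(t)g(t)\,dt-\|g\|_p\big|\le\gamma$. Here $\Psi_{I_N}$ consists of the representers $\psi_{ij}=\psi_{f_i-f_j}$, one for each ordered pair $i\neq j$. For $\psi\in\Psi_{I_N}$, $\Delta_i(\psi):=\int\psi(t)Y_\varepsilon(dt)-\int\psi(t)f_i(t)\,dt=\int\psi(t)[f(t)-f_i(t)]\,dt+\varepsilon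 Z(\psi)$. Conventions: probe functions are nonzero and all integrals and norms appearing are finite; ties in $\arg\min$ are broken arbitrarily (measurably). *)

theory Defs
  imports "HOL-Probability.Probability"
begin

section \<open>Lebesgue spaces on the unit cube\<close>

text \<open>The cube is $[0,1]^d$ with $d$ the cardinality of the index type. Functions on the cube
  are represented by functions on the whole space; norms and integrals see only their values
  on the cube.\<close>

type_synonym 'd func = "real ^ 'd \<Rightarrow> real"

definition unit_cube :: "(real ^ 'd) set" where
  "unit_cube = {t. \<forall>k. 0 \<le> t $ k \<and> t $ k \<le> 1}"

abbreviation cube_measure :: "(real ^ 'd) measure" where
  "cube_measure \<equiv> lebesgue_on unit_cube"

definition Lp_space :: "ennreal \<Rightarrow> ('d::finite) func set" where
  "Lp_space p = {f \<in> borel_measurable cube_measure.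
     if p = \<infinity> then esssup cube_measure (\<lambda>t. ereal \<bar>f t\<bar>) < \<infinity>
     else integrable cube_measure (\<lambda>t. \<bar>f t\<bar> powr enn2real p)}"

text \<open>The value is the genuine norm for members of the corresponding space only.\<close>

definition Lp_norm :: "ennreal \<Rightarrow> ('d::finite) func \<Rightarrow> real" where
  "Lp_norm p f =
     (if p = \<infinity> then real_of_ereal (esssup cube_measure (\<lambda>t. ereal \<bar>f t\<bar>))
      else (LINT t|cube_measure. \<bar>f t\<bar> powr enn2real p) powr (1 / enn2real p))"

definition pairing :: "('d::finite) func \<Rightarrow> 'd func \<Rightarrow> real" where
  "pairing \<psi> g = (LINT t|cube_measure. \<psi> t * g t)"


section \<open>Gaussian white noise\<close>

text \<open>Degenerate (almost surely constant) variables count as Gaussian.\<close>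

definition gaussian_rv :: "'w measure \<Rightarrow> ('w \<Rightarrow> real) \<Rightarrow> bool" where
  "gaussian_rv M X \<longleftrightarrow> X \<in> borel_measurable M \<and>
     (\<exists>\<mu>. (AE \<omega> in M. X \<omega> = \<mu>) \<or> (\<exists>\<sigma>>0. distributed M lborel X (normal_density \<mu> \<sigma>)))"

definition gaussian_process :: "'w measure \<Rightarrow> 'i set \<Rightarrow> ('i \<Rightarrow> 'w \<Rightarrow> real) \<Rightarrow> bool" where
  "gaussian_process M T X \<longleftrightarrow>
     (\<forall>S a. finite S \<and> S \<subseteq> T \<longrightarrow> gaussian_rv M (\<lambda>\<omega>. \<Sum>t\<in>S. a t * X t \<omega>))"

text \<open>The process $Z(\psi) = \int \psi(t)\, W(dt)$. As usual for stochastic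
  integrals, linearity is required almost surely, for each linear combination separately.\<close>

definition white_noise :: "'w measure \<Rightarrow> (('d::finite) func \<Rightarrow> 'w \<Rightarrow> real) \<Rightarrow> bool" where
  "white_noise M Z \<longleftrightarrow>
     gaussian_process M (Lp_space 2) Z \<and>
     (\<forall>\<psi>\<in>Lp_space 2. \<forall>\<phi>\<in>Lp_space 2. \<forall>a b.
        AE \<omega> in M. Z (\<lambda>t. a * \<psi> t + b * \<phi> t) \<omega> = a * Z \<psi> \<omega> + b * Z \<phi> \<omega>) \<and>
     (\<forall>\<psi>\<in>Lp_space 2. (LINT \<omega>|M. Z \<psi> \<omega>) = 0) \<and>
     (\<forall>\<psi>\<in>Lp_space 2. \<forall>\<phi>\<in>Lp_space 2. (LINT \<omega>|M. Z \<psi> \<omega> * Z \<phi> \<omega>) = pairing \<psi> \<phi>)"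

text \<open>The observation $\int \psi(t)\, Y_\varepsilon(dt)$ when the signal is \<open>f\<close>.\<close>

definition observation ::
  "real \<Rightarrow> ('d::finite) func \<Rightarrow> ('d func \<Rightarrow> 'w \<Rightarrow> real) \<Rightarrow> 'd func \<Rightarrow> 'w \<Rightarrow> real" where
  "observation \<epsilon> f Z \<psi> \<omega> = pairing \<psi> f + \<epsilon> * Z \<psi> \<omega>"

definition risk :: "'w measure \<Rightarrow> ennreal \<Rightarrow> ('w \<Rightarrow> ('d::finite) func) \<Rightarrow> 'd func \<Rightarrow> real" where
  "risk M p est f = (LINT \<omega>|M. Lp_norm p (\<lambda>t. est \<omega> t - f t))"


section \<open>Good sets and the selection rule\<close>

definition representer :: "real \<Rightarrow> ennreal \<Rightarrow> ('d::finite) func \<Rightarrow> 'd func \<Rightarrow> bool" where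
  "representer \<gamma> p g \<psi> \<longleftrightarrow> \<bar>pairing \<psi> g - Lp_norm p g\<bar> \<le> \<gamma>"

definition good_set :: "real \<Rightarrow> ennreal \<Rightarrow> ('d::finite) func set \<Rightarrow> 'd func set \<Rightarrow> bool" where
  "good_set \<gamma> p \<Psi> G \<longleftrightarrow> (\<forall>g\<in>G. \<exists>\<psi>\<in>\<Psi>. representer \<gamma> p g \<psi>)"

definition noise_quantile ::
  "'w measure \<Rightarrow> (('d::finite) func \<Rightarrow> 'w \<Rightarrow> real) \<Rightarrow> real \<Rightarrow> 'd func set \<Rightarrow> real" where
  "noise_quantile M Z \<delta> \<Psi> =
     (LEAST k. 0 < k \<and>
        measure M {\<omega> \<in> space M. k \<le> (MAX \<psi>\<in>\<Psi>. \<bar>Z \<psi> \<omega>\<bar> / Lp_norm 2 \<psi>)} \<le> \<delta>)"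

text \<open>In the next two definitions \<open>y\<close> is the observed data, a functional of the probe function,
  and \<open>g\<close> is a candidate for the signal.\<close>

definition discrepancy :: "(('d::finite) func \<Rightarrow> real) \<Rightarrow> 'd func \<Rightarrow> 'd func \<Rightarrow> real" where
  "discrepancy y g \<psi> = y \<psi> - pairing \<psi> g"

definition criterion ::
  "real \<Rightarrow> real \<Rightarrow> ennreal \<Rightarrow> ('d::finite) func set \<Rightarrow> ('d func \<Rightarrow> real) \<Rightarrow> 'd func \<Rightarrow> real" where
  "criterion \<epsilon> \<kappa> q \<Psi> y g =
     (MAX \<psi>\<in>\<Psi>. 1 / Lp_norm q \<psi> * (\<bar>discrepancy y g \<psi>\<bar> - \<epsilon> * \<kappa> * Lp_norm 2 \<psi>))"

end

theory Submission
  imports Defs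
begin

text \<open>The proof compares the selected candidate \<open>h\<close> with the best one \<open>g\<close> through the single
  probe \<open>\<phi>\<close> that represents \<open>g - h\<close>. Up to \<open>\<gamma>\<close>, the distance \<open>\<parallel>g - h\<parallel>\<^sub>p\<close> is
  \<open>\<integral>\<phi>(g - h)\<close>, and this number is a difference of two discrepancies of the data at \<open>\<phi>\<close>,
  that of \<open>h\<close> minus that of \<open>g\<close>: the unknown signal and the noise cancel. Each discrepancy is
  at most \<open>\<parallel>\<phi>\<parallel>\<^sub>q\<close> times the criterion of its candidate plus \<open>\<epsilon> \<kappa> \<parallel>\<phi>\<parallel>\<^sub>2\<close>, the selected candidate has the smaller criterion,
  and by Holder's inequality the criterion of \<open>g\<close> is at most \<open>\<parallel>f - g\<parallel>\<^sub>p\<close> as soon as every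
  \<open>\<bar>Z \<phi>\<bar>\<close> is at most \<open>\<kappa> \<parallel>\<phi>\<parallel>\<^sub>2\<close>. The triangle inequality then gives the
  deterministic bound \<open>selection_error_bound\<close>.

  The noise condition fails with probability at most \<open>\<delta>\<close>. This is the defining property of
  \<open>\<kappa>\<close>, but it needs that the least admissible threshold exists, which is
  \<open>noise_quantile_attained\<close>: the maximum of the normalised noise has no atoms, because each
  \<open>Z \<phi>\<close> with \<open>\<phi>\<close> nonzero is a nondegenerate Gaussian variable, so its tail probability is
  continuous in the threshold. On the exceptional event the loss is bounded by
  \<open>\<parallel>f\<parallel>\<^sub>p + max \<parallel>F i\<parallel>\<^sub>p\<close>, which contributes the last term of the risk bound.\<close>

section \<open>Norms on the unit cube\<close>

lemma emeasure_cube_measure: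
  "emeasure cube_measure (space (cube_measure :: (real ^ 'd::finite) measure)) = 1"
proof -
  have cube: "(unit_cube :: (real ^ 'd) set) = cbox 0 1"
    by (auto simp: unit_cube_def mem_box_cart)
  have "emeasure lebesgue (unit_cube :: (real ^ 'd) set) = ennreal (measure lborel (cbox 0 1 :: (real ^ 'd) set))"
    unfolding cube using emeasure_lborel_cbox_finite[of 0 "1 :: real ^ 'd"]
    by (simp add: emeasure_eq_ennreal_measure)
  also have "measure lborel (cbox 0 1 :: (real ^ 'd) set) = 1"
    by (subst content_cbox_cart) (auto simp: interval_ne_empty_cart)
  finally show ?thesis
    by (simp add: emeasure_restrict_space cube)
qed

lemma Lp_space_measurable: "f \<in> Lp_space p \<Longrightarrow> f \<in> borel_measurable cube_measure"
  by (simp add: Lp_space_def)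

lemma Lp_space_finite_iff:
  "0 < r \<Longrightarrow> f \<in> Lp_space (ennreal r) \<longleftrightarrow>
     f \<in> borel_measurable cube_measure \<and> integrable cube_measure (\<lambda>t. \<bar>f t\<bar> powr r)"
  by (auto simp: Lp_space_def)

lemma Lp_norm_finite:
  "0 < r \<Longrightarrow> Lp_norm (ennreal r) f = (LINT t|cube_measure. \<bar>f t\<bar> powr r) powr (1 / r)"
  by (simp add: Lp_norm_def)

text \<open>The essential supremum over a null space would be \<open>- \<infinity>\<close>; the bound holds because the
  cube has positive measure.\<close>

lemma esssup_abs_nonneg:
  fixes f :: "('d::finite) func"
  shows "0 \<le> esssup cube_measure (\<lambda>t. ereal \<bar>f t\<bar>)"
proof (cases "(\<lambda>t. ereal \<bar>f t\<bar>) \<in> borel_measurable cube_measure")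
  case True
  have "esssup cube_measure (\<lambda>t::real^'d. 0::ereal) \<le> esssup cube_measure (\<lambda>t. ereal \<bar>f t\<bar>)"
    by (intro esssup_AE_mono) auto
  then show ?thesis
    using esssup_const[of "cube_measure :: (real ^ 'd) measure" "0::ereal"]
      emeasure_cube_measure[where 'd = 'd] by simp
qed (simp add: esssup_non_measurable)

lemma Lp_norm_nonneg: "0 \<le> Lp_norm p f"
  using esssup_abs_nonneg[of f] by (auto simp: Lp_norm_def real_of_ereal_pos)

lemma Lp_norm_commute: "Lp_norm p (\<lambda>t. f t - g t) = Lp_norm p (\<lambda>t. g t - f t)"
  by (simp add: Lp_norm_def abs_minus_commute)

lemma esssup_eq_Linf_norm:
  assumes "f \<in> Lp_space \<infinity>"
  shows "esssup cube_measure (\<lambda>t. ereal \<bar>f t\<bar>) = ereal (Lp_norm \<infinity> f)"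
  using assms esssup_abs_nonneg[of f]
  by (cases "esssup cube_measure (\<lambda>t. ereal \<bar>f t\<bar>)") (auto simp: Lp_space_def Lp_norm_def)

lemma AE_le_Linf_norm:
  assumes "f \<in> Lp_space \<infinity>"
  shows "AE t in cube_measure. \<bar>f t\<bar> \<le> Lp_norm \<infinity> f"
  using esssup_AE[of "\<lambda>t. ereal \<bar>f t\<bar>" cube_measure] esssup_eq_Linf_norm[OF assms] by simp

text \<open>Together with \<open>AE_le_Linf_norm\<close> this characterises the norm as the least essential bound.\<close>

lemma Linf_normI:
  assumes [measurable]: "f \<in> borel_measurable cube_measure"
    and "AE t in cube_measure. \<bar>f t\<bar> \<le> c"
  shows "f \<in> Lp_space \<infinity>" "Lp_norm \<infinity> f \<le> c"
proof -
  have le: "esssup cube_measure (\<lambda>t. ereal \<bar>f t\<bar>) \<le> ereal c"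
    by (rule esssup_I) (use assms(2) in auto)
  show *: "f \<in> Lp_space \<infinity>"
    using le by (auto simp: Lp_space_def intro: le_less_trans)
  show "Lp_norm \<infinity> f \<le> c"
    using le esssup_eq_Linf_norm[OF *] by simp
qed

text \<open>Scaling by an upper bound \<open>s\<close> of the norm, instead of by the norm itself, turns norm bounds
  into bounds by 1 of an integral, to which a pointwise inequality can be applied. As \<open>s\<close> is
  positive even when the norm vanishes, the proofs of the Holder and Minkowski inequalities need
  no separate treatment of functions that vanish almost everywhere.\<close>

lemma Lp_norm_le_iff_modular:
  assumes r: "0 < r" and s: "0 < s" and f: "f \<in> Lp_space (ennreal r)"
  shows "Lp_norm (ennreal r) f \<le> s \<longleftrightarrow> (LINT t|cube_measure. (\<bar>f t\<bar> / s) powr r) \<le> 1"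
proof -
  define I where "I = (LINT t|cube_measure. \<bar>f t\<bar> powr r)"
  have "0 \<le> I" by (simp add: I_def)
  have "(LINT t|cube_measure. (\<bar>f t\<bar> / s) powr r) = I / s powr r"
    using s by (simp add: powr_divide I_def)
  moreover have "I powr (1 / r) \<le> s \<longleftrightarrow> I \<le> s powr r"
  proof
    assume "I powr (1 / r) \<le> s"
    then have "(I powr (1 / r)) powr r \<le> s powr r"
      using r by (intro powr_mono2) auto
    then show "I \<le> s powr r" using r \<open>0 \<le> I\<close> by (simp add: powr_powr)
  next
    assume "I \<le> s powr r"
    then have "I powr (1 / r) \<le> (s powr r) powr (1 / r)"
      using r \<open>0 \<le> I\<close> by (intro powr_mono2) auto
    then show "I powr (1 / r) \<le> s" using r s by (simp add: powr_powr)
  qed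
  ultimately show ?thesis
    using s by (simp add: Lp_norm_finite[OF r] I_def[symmetric] divide_le_eq_1_pos)
qed

lemma integrable_modular:
  assumes "0 < r" "0 < s" "f \<in> Lp_space (ennreal r)"
  shows "integrable cube_measure (\<lambda>t. (\<bar>f t\<bar> / s) powr r)"
  using assms by (simp add: powr_divide Lp_space_finite_iff)

lemma Lp_norm_pos:
  assumes p: "1 \<le> p" and f: "f \<in> Lp_space p" and nz: "\<not> (AE t in cube_measure. f t = 0)"
  shows "0 < Lp_norm p f"
proof (rule ccontr)
  assume "\<not> 0 < Lp_norm p f"
  then have 0: "Lp_norm p f = 0" using Lp_norm_nonneg[of p f] by simp
  have "AE t in cube_measure. f t = 0"
  proof (cases "p = \<infinity>")
    case True
    then show ?thesis using AE_le_Linf_norm[of f] f 0 by simp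
  next
    case False
    then obtain r where r: "p = ennreal r" "0 \<le> r" by (cases p) auto
    with p have "1 \<le> r" by simp
    then have "(LINT t|cube_measure. \<bar>f t\<bar> powr r) = 0"
      using 0 by (simp add: r(1) Lp_norm_finite)
    then show ?thesis
      using f \<open>1 \<le> r\<close> integral_nonneg_eq_0_iff_AE[of cube_measure "\<lambda>t. \<bar>f t\<bar> powr r"]
      by (simp add: r(1) Lp_space_finite_iff)
  qed
  with nz show False by simp
qed

section \<open>Holder's inequality\<close>

lemma le_mult_limit:
  fixes x A B :: real
  assumes "\<And>a b. A < a \<Longrightarrow> B < b \<Longrightarrow> x \<le> a * b"
  shows "x \<le> A * B"
proof (rule tendsto_lowerbound)
  show "((\<lambda>e. (A + e) * (B + e)) \<longlongrightarrow> A * B) (at_right 0)"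
    by (auto intro!: tendsto_eq_intros)
  show "\<forall>\<^sub>F e in at_right 0. x \<le> (A + e) * (B + e)"
    using assms by (auto simp: eventually_at_right_field intro!: exI[of _ 1])
qed simp

lemma Holder_one_infinity:
  assumes g: "g \<in> Lp_space 1" and h: "h \<in> Lp_space \<infinity>"
  shows "integrable cube_measure (\<lambda>t. g t * h t)"
    and "(LINT t|cube_measure. \<bar>g t * h t\<bar>) \<le> Lp_norm 1 g * Lp_norm \<infinity> h"
proof -
  note [measurable] = g[THEN Lp_space_measurable] h[THEN Lp_space_measurable]
  have int: "integrable cube_measure (\<lambda>t. \<bar>g t\<bar>)"
    using g Lp_space_finite_iff[of 1 g] by (simp add: powr_one)
  have bound: "AE t in cube_measure. \<bar>g t * h t\<bar> \<le> \<bar>g t\<bar> * Lp_norm \<infinity> h"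
    using AE_le_Linf_norm[OF h] by eventually_elim (simp add: abs_mult mult_left_mono)
  have int': "integrable cube_measure (\<lambda>t. \<bar>g t\<bar> * Lp_norm \<infinity> h)"
    using int by simp
  show int'': "integrable cube_measure (\<lambda>t. g t * h t)"
    by (rule Bochner_Integration.integrable_bound[OF int'])
      (use bound Lp_norm_nonneg[of \<infinity> h] in \<open>auto simp: abs_mult\<close>)
  have "(LINT t|cube_measure. \<bar>g t * h t\<bar>) \<le> (LINT t|cube_measure. \<bar>g t\<bar> * Lp_norm \<infinity> h)"
    using int'' int' bound by (intro integral_mono_AE) auto
  also have "\<dots> = Lp_norm 1 g * Lp_norm \<infinity> h"
    using Lp_norm_finite[of 1 g] by (simp add: powr_one)
  finally show "(LINT t|cube_measure. \<bar>g t * h t\<bar>) \<le> Lp_norm 1 g * Lp_norm \<infinity> h" .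
qed

text \<open>Young's inequality for \<open>\<bar>g\<bar> / a\<close> and \<open>\<bar>h\<bar> / b\<close>, with \<open>a\<close> and \<open>b\<close> slightly above
  the two norms, integrates to \<open>\<integral>\<bar>g h\<bar> \<le> a b\<close>; then \<open>a\<close> and \<open>b\<close> tend to the norms.\<close>

lemma Holder_finite:
  assumes rs: "1 < r" "1 < s" "1 / r + 1 / s = (1::real)"
    and g: "g \<in> Lp_space (ennreal r)" and h: "h \<in> Lp_space (ennreal s)"
  shows "integrable cube_measure (\<lambda>t. g t * h t)"
    and "(LINT t|cube_measure. \<bar>g t * h t\<bar>) \<le> Lp_norm (ennreal r) g * Lp_norm (ennreal s) h"
proof -
  note [measurable] = g[THEN Lp_space_measurable] h[THEN Lp_space_measurable]
  have young: "\<bar>g t * h t\<bar> \<le> a * b * ((\<bar>g t\<bar> / a) powr r / r + (\<bar>h t\<bar> / b) powr s / s)"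
    if "0 < a" "0 < b" for a b t
    using Youngs_inequality[OF rs, of "\<bar>g t\<bar> / a" "\<bar>h t\<bar> / b"] that
    by (simp add: field_simps abs_mult)
  have int: "integrable cube_measure
      (\<lambda>t. a * b * ((\<bar>g t\<bar> / a) powr r / r + (\<bar>h t\<bar> / b) powr s / s))"
    if "0 < a" "0 < b" for a b
    using that rs g h integrable_modular[of r a g] integrable_modular[of s b h] by simp
  \<comment> \<open>For integrability alone any scaling serves, here \<open>a = b = 1\<close>.\<close>
  show int_gh: "integrable cube_measure (\<lambda>t. g t * h t)"
  proof (rule Bochner_Integration.integrable_bound[OF int[of 1 1]])
    show "AE t in cube_measure. norm (g t * h t) \<le>
        norm (1 * 1 * ((\<bar>g t\<bar> / 1) powr r / r + (\<bar>h t\<bar> / 1) powr s / s))"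
      using young[of 1 1] rs by (intro AE_I2) force
  qed auto
  show "(LINT t|cube_measure. \<bar>g t * h t\<bar>) \<le> Lp_norm (ennreal r) g * Lp_norm (ennreal s) h"
  proof (rule le_mult_limit)
    fix a b assume ab: "Lp_norm (ennreal r) g < a" "Lp_norm (ennreal s) h < b"
    then have pos: "0 < a" "0 < b"
      using Lp_norm_nonneg[of "ennreal r" g] Lp_norm_nonneg[of "ennreal s" h] by linarith+
    define G where "G = (LINT t|cube_measure. (\<bar>g t\<bar> / a) powr r)"
    define H where "H = (LINT t|cube_measure. (\<bar>h t\<bar> / b) powr s)"
    have GH: "G \<le> 1" "H \<le> 1"
      using ab pos rs g h Lp_norm_le_iff_modular[of r a g] Lp_norm_le_iff_modular[of s b h]
      by (auto simp: G_def H_def)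
    have "(LINT t|cube_measure. \<bar>g t * h t\<bar>) \<le>
        (LINT t|cube_measure. a * b * ((\<bar>g t\<bar> / a) powr r / r + (\<bar>h t\<bar> / b) powr s / s))"
      using int_gh int[OF pos] young[OF pos] by (intro integral_mono) auto
    also have "\<dots> = a * b * (G / r + H / s)"
      using pos rs g h integrable_modular[of r a g] integrable_modular[of s b h]
      by (simp add: G_def H_def)
    also have "\<dots> \<le> a * b * (1 / r + 1 / s)"
      using GH pos rs by (intro mult_left_mono add_mono divide_right_mono) auto
    finally show "(LINT t|cube_measure. \<bar>g t * h t\<bar>) \<le> a * b"
      using rs by simp
  qed
qed

lemma ennreal_inverse_eq_1_iff: "inverse x = 1 \<longleftrightarrow> x = (1 :: ennreal)"
proof (cases x)
  case (real r)
  then show ?thesis by (cases "r = 0") (auto simp: inverse_ennreal)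
qed simp

lemma conjugate_exponent_cases:
  fixes p q :: ennreal
  assumes "1 \<le> p" "inverse p + inverse q = 1"
  obtains "p = 1" "q = \<infinity>" | "p = \<infinity>" "q = 1"
    | r s :: real where "p = ennreal r" "q = ennreal s" "1 < r" "1 < s" "1 / s + 1 / r = 1"
proof (cases "p = \<infinity>")
  case True
  then have "inverse q = 1" using assms by simp
  then have "q = 1" by (simp add: ennreal_inverse_eq_1_iff)
  with True show ?thesis using that by simp
next
  case False
  then obtain r where r: "p = ennreal r" "0 \<le> r" by (cases p) auto
  with assms have "1 \<le> r" by simp
  show ?thesis
  proof (cases "q = \<infinity>")
    case True
    then have "inverse p = 1" using assms by simp
    then have "p = 1" by (simp add: ennreal_inverse_eq_1_iff)
    with True show ?thesis using that by simp
  next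
    case False
    then obtain s where s: "q = ennreal s" "0 \<le> s" by (cases q) auto
    have "s \<noteq> 0" using assms s by auto
    with s have "0 < s" by simp
    have "ennreal (inverse r + inverse s) = 1"
      using assms r s \<open>1 \<le> r\<close> \<open>0 < s\<close> by (simp add: inverse_ennreal)
    then have *: "inverse r + inverse s = 1" by simp
    have "inverse r < 1" "inverse s < 1" using * \<open>1 \<le> r\<close> \<open>0 < s\<close> 
      by (smt (verit) inverse_positive_iff_positive)+
    then have "1 < r" "1 < s" using \<open>1 \<le> r\<close> \<open>0 < s\<close> by (auto simp: field_simps)
    then show ?thesis using that(3)[OF r(1) s(1)] * by (simp add: field_simps)
  qed
qed

text \<open>Integrability is part of the conclusion because linearity of the pairing rests on it.\<close>

lemma Holder_inequality:
  assumes conj: "1 \<le> p" "inverse p + inverse q = 1"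
    and g: "g \<in> Lp_space q" and h: "h \<in> Lp_space p"
  shows "integrable cube_measure (\<lambda>t. g t * h t)"
    and "\<bar>pairing g h\<bar> \<le> Lp_norm q g * Lp_norm p h"
proof -
  have "integrable cube_measure (\<lambda>t. g t * h t) \<and>
    (LINT t|cube_measure. \<bar>g t * h t\<bar>) \<le> Lp_norm q g * Lp_norm p h"
    using conj
  proof (cases rule: conjugate_exponent_cases)
    case 1
    then show ?thesis using Holder_one_infinity[of h g] g h by (simp add: mult.commute)
  next
    case 2
    then show ?thesis using Holder_one_infinity[of g h] g h by simp
  next
    case (3 r s)
    then show ?thesis using Holder_finite[of s r g h] g h by simp
  qed
  then show "integrable cube_measure (\<lambda>t. g t * h t)"
    and "\<bar>pairing g h\<bar> \<le> Lp_norm q g * Lp_norm p h"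
    by (auto simp: pairing_def intro: order_trans[OF integral_abs_bound])
qed

section \<open>Minkowski's inequality\<close>

text \<open>Convexity of \<open>x powr r\<close> on the closed half-line: at the endpoint 0, where \<open>powr\<close> is not
  covered by the derivative test, it reduces to \<open>c powr r \<le> c\<close>.\<close>

lemma powr_convex_combination:
  fixes u v c r :: real
  assumes "1 \<le> r" "0 \<le> u" "0 \<le> v" "0 < c" "c < 1"
  shows "(c * u + (1 - c) * v) powr r \<le> c * u powr r + (1 - c) * v powr r"
proof (cases "u = 0 \<or> v = 0")
  case False
  then show ?thesis
    using convex_onD[OF powr_convex[OF assms(1)], of "1 - c" u v] assms by simp
next
  case True
  have shrink: "(\<mu> * w) powr r \<le> \<mu> * w powr r" if "0 < \<mu>" "\<mu> < 1" "0 \<le> w" for \<mu> w :: real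
    using that assms(1) powr_le_one_le[of \<mu> r] by (simp add: powr_mult mult_right_mono)
  show ?thesis
    using True shrink[of c u] shrink[of "1 - c" v] assms by auto
qed

text \<open>With \<open>a\<close> and \<open>b\<close> slightly above the norms, \<open>(\<bar>g\<bar> + \<bar>h\<bar>) / (a + b)\<close> is the convex
  combination of \<open>\<bar>g\<bar> / a\<close> and \<open>\<bar>h\<bar> / b\<close> with weights \<open>a / (a + b)\<close> and \<open>b / (a + b)\<close>.
  Convexity of the power bounds the integral for the sum by the same combination of two integrals
  that are at most 1, so that the sum has norm at most \<open>a + b\<close>.\<close>

lemma Minkowski_finite:
  assumes r: "1 \<le> r" and g: "g \<in> Lp_space (ennreal r)" and h: "h \<in> Lp_space (ennreal r)"
  shows "(\<lambda>t. g t + h t) \<in> Lp_space (ennreal r)"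
    and "Lp_norm (ennreal r) (\<lambda>t. g t + h t) \<le> Lp_norm (ennreal r) g + Lp_norm (ennreal r) h"
proof -
  note [measurable] = g[THEN Lp_space_measurable] h[THEN Lp_space_measurable]
  have r0: "0 < r" using r by simp
  have convex: "(\<bar>g t + h t\<bar> / (a + b)) powr r \<le>
      a / (a + b) * (\<bar>g t\<bar> / a) powr r + b / (a + b) * (\<bar>h t\<bar> / b) powr r"
    if ab: "0 < a" "0 < b" for a b t
  proof -
    have "(\<bar>g t + h t\<bar> / (a + b)) powr r \<le> ((\<bar>g t\<bar> + \<bar>h t\<bar>) / (a + b)) powr r"
      using ab r by (intro powr_mono2 divide_right_mono) auto
    also have "(\<bar>g t\<bar> + \<bar>h t\<bar>) / (a + b) =
        a / (a + b) * (\<bar>g t\<bar> / a) + (1 - a / (a + b)) * (\<bar>h t\<bar> / b)"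
      using ab by (simp add: divide_simps)
    also have "\<dots> powr r \<le> a / (a + b) * (\<bar>g t\<bar> / a) powr r
        + (1 - a / (a + b)) * (\<bar>h t\<bar> / b) powr r"
      using ab r by (intro powr_convex_combination) auto
    also have "1 - a / (a + b) = b / (a + b)"
      using ab by (simp add: field_simps)
    finally show ?thesis .
  qed
  have int: "integrable cube_measure
      (\<lambda>t. a / (a + b) * (\<bar>g t\<bar> / a) powr r + b / (a + b) * (\<bar>h t\<bar> / b) powr r)"
    if "0 < a" "0 < b" for a b
    using that integrable_modular[OF r0 _ g, of a] integrable_modular[OF r0 _ h, of b] by simp
  have int_sum: "integrable cube_measure (\<lambda>t. (\<bar>g t + h t\<bar> / (a + b)) powr r)"
    if ab: "0 < a" "0 < b" for a b
    by (rule Bochner_Integration.integrable_bound[OF int[OF ab]])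
      (use convex[OF ab] in \<open>auto intro!: AE_I2 order_trans[OF _ abs_ge_self]\<close>)
  \<comment> \<open>The choice \<open>a = b = 1\<close> shows that \<open>(\<bar>g + h\<bar> / 2) powr r\<close> is integrable.\<close>
  have "integrable cube_measure (\<lambda>t. 2 powr r * (\<bar>g t + h t\<bar> / (1 + 1)) powr r)"
    using int_sum[of 1 1] by simp
  then show sum: "(\<lambda>t. g t + h t) \<in> Lp_space (ennreal r)"
    using r by (simp add: Lp_space_finite_iff powr_divide)
  show "Lp_norm (ennreal r) (\<lambda>t. g t + h t) \<le> Lp_norm (ennreal r) g + Lp_norm (ennreal r) h"
  proof (rule field_le_epsilon)
    fix e :: real assume "0 < e"
    define a where "a = Lp_norm (ennreal r) g + e / 2"
    define b where "b = Lp_norm (ennreal r) h + e / 2"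
    have ab: "0 < a" "0 < b"
      using \<open>0 < e\<close> Lp_norm_nonneg[of "ennreal r" g] Lp_norm_nonneg[of "ennreal r" h]
      by (auto simp: a_def b_def)
    have "(LINT t|cube_measure. (\<bar>g t\<bar> / a) powr r) \<le> 1"
      using Lp_norm_le_iff_modular[OF r0 ab(1) g] \<open>0 < e\<close> by (simp add: a_def)
    moreover have "(LINT t|cube_measure. (\<bar>h t\<bar> / b) powr r) \<le> 1"
      using Lp_norm_le_iff_modular[OF r0 ab(2) h] \<open>0 < e\<close> by (simp add: b_def)
    ultimately have "a / (a + b) * (LINT t|cube_measure. (\<bar>g t\<bar> / a) powr r)
        + b / (a + b) * (LINT t|cube_measure. (\<bar>h t\<bar> / b) powr r) \<le> a / (a + b) * 1 + b / (a + b) * 1"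
      using ab by (intro add_mono mult_left_mono) auto
    also have "\<dots> = 1" using ab by (simp flip: add_divide_distrib)
    finally have "(LINT t|cube_measure. (\<bar>g t + h t\<bar> / (a + b)) powr r) \<le> 1"
      using integral_mono[OF int_sum[OF ab] int[OF ab] convex[OF ab]]
        integrable_modular[OF r0 ab(1) g] integrable_modular[OF r0 ab(2) h] by simp
    then have "Lp_norm (ennreal r) (\<lambda>t. g t + h t) \<le> a + b"
      using Lp_norm_le_iff_modular[OF r0 _ sum, of "a + b"] ab by simp
    then show "Lp_norm (ennreal r) (\<lambda>t. g t + h t)
        \<le> Lp_norm (ennreal r) g + Lp_norm (ennreal r) h + e"
      by (simp add: a_def b_def)
  qed
qed

lemma Minkowski_infinity:
  assumes g: "g \<in> Lp_space \<infinity>" and h: "h \<in> Lp_space \<infinity>"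
  shows "(\<lambda>t. g t + h t) \<in> Lp_space \<infinity>"
    and "Lp_norm \<infinity> (\<lambda>t. g t + h t) \<le> Lp_norm \<infinity> g + Lp_norm \<infinity> h"
proof -
  note [measurable] = g[THEN Lp_space_measurable] h[THEN Lp_space_measurable]
  have "AE t in cube_measure. \<bar>g t + h t\<bar> \<le> Lp_norm \<infinity> g + Lp_norm \<infinity> h"
    using AE_le_Linf_norm[OF g] AE_le_Linf_norm[OF h] by eventually_elim linarith
  then show "(\<lambda>t. g t + h t) \<in> Lp_space \<infinity>"
    and "Lp_norm \<infinity> (\<lambda>t. g t + h t) \<le> Lp_norm \<infinity> g + Lp_norm \<infinity> h"
    by (intro Linf_normI; measurable)+
qed

lemma Minkowski_inequality:
  assumes p: "1 \<le> p" and g: "g \<in> Lp_space p" and h: "h \<in> Lp_space p"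
  shows "(\<lambda>t. g t + h t) \<in> Lp_space p"
    and "Lp_norm p (\<lambda>t. g t + h t) \<le> Lp_norm p g + Lp_norm p h"
proof -
  have "(\<lambda>t. g t + h t) \<in> Lp_space p \<and> Lp_norm p (\<lambda>t. g t + h t) \<le> Lp_norm p g + Lp_norm p h"
  proof (cases "p = \<infinity>")
    case True
    then show ?thesis using Minkowski_infinity[of g h] g h by simp
  next
    case False
    then obtain r where r: "p = ennreal r" "0 \<le> r" by (cases p) auto
    with p have "1 \<le> r" by simp
    then show ?thesis using Minkowski_finite[of r g h] g h r by simp
  qed
  then show "(\<lambda>t. g t + h t) \<in> Lp_space p"
    and "Lp_norm p (\<lambda>t. g t + h t) \<le> Lp_norm p g + Lp_norm p h" by auto
qed

lemma Lp_uminus: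
  "f \<in> Lp_space p \<Longrightarrow> (\<lambda>t. - f t) \<in> Lp_space p"
  "Lp_norm p (\<lambda>t. - f t) = Lp_norm p f"
  by (auto simp: Lp_space_def Lp_norm_def)

lemma Lp_diff:
  assumes "1 \<le> p" "g \<in> Lp_space p" "h \<in> Lp_space p"
  shows "(\<lambda>t. g t - h t) \<in> Lp_space p"
    and "Lp_norm p (\<lambda>t. g t - h t) \<le> Lp_norm p g + Lp_norm p h"
  using Minkowski_inequality[OF assms(1,2) Lp_uminus(1)[OF assms(3)]]
  by (simp_all add: Lp_uminus(2))

lemma Lp_triangle:
  assumes "1 \<le> p" "f \<in> Lp_space p" "g \<in> Lp_space p" "h \<in> Lp_space p"
  shows "Lp_norm p (\<lambda>t. f t - h t) \<le> Lp_norm p (\<lambda>t. f t - g t) + Lp_norm p (\<lambda>t. g t - h t)"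
  using Minkowski_inequality(2)[OF assms(1) Lp_diff(1)[OF assms(1,2,3)] Lp_diff(1)[OF assms(1,3,4)]]
  by simp


section \<open>The error of the selected candidate\<close>

lemma pairing_diff:
  assumes "1 \<le> p" "inverse p + inverse q = 1"
    and "\<phi> \<in> Lp_space q" "g \<in> Lp_space p" "h \<in> Lp_space p"
  shows "pairing \<phi> (\<lambda>t. g t - h t) = pairing \<phi> g - pairing \<phi> h"
  using Holder_inequality(1)[OF assms(1,2,3,4)] Holder_inequality(1)[OF assms(1,2,3,5)]
  by (simp add: pairing_def right_diff_distrib)

lemma discrepancy_le_criterion:
  assumes "finite \<Psi>" "\<phi> \<in> \<Psi>" "0 < Lp_norm q \<phi>"
  shows "\<bar>discrepancy y g \<phi>\<bar> \<le> Lp_norm q \<phi> * criterion \<epsilon> \<kappa> q \<Psi> y g + \<epsilon> * \<kappa> * Lp_norm 2 \<phi>"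
proof -
  have "1 / Lp_norm q \<phi> * (\<bar>discrepancy y g \<phi>\<bar> - \<epsilon> * \<kappa> * Lp_norm 2 \<phi>) \<le> criterion \<epsilon> \<kappa> q \<Psi> y g"
    unfolding criterion_def using assms by (intro Max_ge) auto
  then show ?thesis using assms(3) by (simp add: field_simps)
qed

text \<open>The discrepancy of \<open>g\<close> at \<open>\<phi>\<close> is the noise plus \<open>\<integral>\<phi>(f - g)\<close>. The subtracted
  penalty absorbs the noise, and dividing by \<open>\<parallel>\<phi>\<parallel>\<^sub>q\<close> makes Holder's bound for the rest
  independent of \<open>\<phi>\<close>.\<close>

lemma criterion_le_error:
  assumes conj: "1 \<le> p" "inverse p + inverse q = 1"
    and \<Psi>: "finite \<Psi>" "\<Psi> \<noteq> {}" "\<Psi> \<subseteq> Lp_space q" "\<And>\<phi>. \<phi> \<in> \<Psi> \<Longrightarrow> 0 < Lp_norm q \<phi>"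
    and f: "f \<in> Lp_space p" and g: "g \<in> Lp_space p"
    and noise: "\<And>\<phi>. \<phi> \<in> \<Psi> \<Longrightarrow> \<bar>y \<phi> - pairing \<phi> f\<bar> \<le> \<epsilon> * \<kappa> * Lp_norm 2 \<phi>"
  shows "criterion \<epsilon> \<kappa> q \<Psi> y g \<le> Lp_norm p (\<lambda>t. f t - g t)"
  unfolding criterion_def
proof (intro Max.boundedI)
  fix m assume "m \<in> (\<lambda>\<phi>. 1 / Lp_norm q \<phi> * (\<bar>discrepancy y g \<phi>\<bar> - \<epsilon> * \<kappa> * Lp_norm 2 \<phi>)) ` \<Psi>"
  then obtain \<phi> where \<phi>: "\<phi> \<in> \<Psi>"
    and m: "m = 1 / Lp_norm q \<phi> * (\<bar>discrepancy y g \<phi>\<bar> - \<epsilon> * \<kappa> * Lp_norm 2 \<phi>)" by auto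
  have \<phi>_Lq: "\<phi> \<in> Lp_space q" using \<phi> \<Psi>(3) by auto
  have "discrepancy y g \<phi> = (y \<phi> - pairing \<phi> f) + pairing \<phi> (\<lambda>t. f t - g t)"
    using pairing_diff[OF conj \<phi>_Lq f g] by (simp add: discrepancy_def)
  then have "\<bar>discrepancy y g \<phi>\<bar> - \<epsilon> * \<kappa> * Lp_norm 2 \<phi> \<le> \<bar>pairing \<phi> (\<lambda>t. f t - g t)\<bar>"
    using noise[OF \<phi>] by linarith
  also have "\<dots> \<le> Lp_norm q \<phi> * Lp_norm p (\<lambda>t. f t - g t)"
    by (rule Holder_inequality(2)[OF conj \<phi>_Lq Lp_diff(1)[OF conj(1) f g]])
  finally show "m \<le> Lp_norm p (\<lambda>t. f t - g t)"
    using \<Psi>(4)[OF \<phi>] by (simp add: m field_simps)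
qed (use \<Psi> in auto)

text \<open>The observations enter \<open>\<integral>\<phi>(g - h)\<close> only through the difference of the discrepancies of
  \<open>h\<close> and \<open>g\<close>. Both are at most \<open>T = \<parallel>\<phi>\<parallel>\<^sub>q \<parallel>f - g\<parallel>\<^sub>p + \<epsilon> \<kappa> \<parallel>\<phi>\<parallel>\<^sub>2\<close>, because
  both criteria are at most \<open>\<parallel>f - g\<parallel>\<^sub>p\<close>; this gives the factors 2. The further
  \<open>\<parallel>f - g\<parallel>\<^sub>p\<close> comes from the triangle inequality.\<close>

lemma selection_error_bound:
  assumes conj: "1 \<le> p" "inverse p + inverse q = 1"
    and \<Psi>: "finite \<Psi>" "\<Psi> \<subseteq> Lp_space q" "\<And>\<phi>. \<phi> \<in> \<Psi> \<Longrightarrow> 0 < Lp_norm q \<phi>"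
    and f: "f \<in> Lp_space p" and g: "g \<in> Lp_space p" and h: "h \<in> Lp_space p"
    and noise: "\<And>\<phi>. \<phi> \<in> \<Psi> \<Longrightarrow> \<bar>y \<phi> - pairing \<phi> f\<bar> \<le> \<epsilon> * \<kappa> * Lp_norm 2 \<phi>"
    and selected: "criterion \<epsilon> \<kappa> q \<Psi> y h \<le> criterion \<epsilon> \<kappa> q \<Psi> y g"
    and \<phi>: "\<phi> \<in> \<Psi>" "representer \<gamma> p (\<lambda>t. g t - h t) \<phi>"
  shows "Lp_norm p (\<lambda>t. h t - f t) \<le>
    (2 * Lp_norm q \<phi> + 1) * Lp_norm p (\<lambda>t. f t - g t) + 2 * \<kappa> * \<epsilon> * Lp_norm 2 \<phi> + \<gamma>"
proof -
  have \<phi>_Lq: "\<phi> \<in> Lp_space q" using \<phi> \<Psi>(2) by auto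
  let ?e = "Lp_norm p (\<lambda>t. f t - g t)"
  have crit: "criterion \<epsilon> \<kappa> q \<Psi> y g \<le> ?e"
    using \<phi>(1) by (intro criterion_le_error[OF conj \<Psi>(1) _ \<Psi>(2,3) f g noise]) auto
  define T where "T = Lp_norm q \<phi> * ?e + \<epsilon> * \<kappa> * Lp_norm 2 \<phi>"
  have disc: "\<bar>discrepancy y k \<phi>\<bar> \<le> T"
    if "criterion \<epsilon> \<kappa> q \<Psi> y k \<le> ?e" for k
    using discrepancy_le_criterion[OF \<Psi>(1) \<phi>(1) \<Psi>(3)[OF \<phi>(1)], of y k \<epsilon> \<kappa>]
      mult_left_mono[OF that Lp_norm_nonneg[of q \<phi>]] by (simp add: T_def)
  have "Lp_norm p (\<lambda>t. g t - h t) \<le> pairing \<phi> (\<lambda>t. g t - h t) + \<gamma>"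
    using \<phi>(2) by (simp add: representer_def)
  also have "pairing \<phi> (\<lambda>t. g t - h t) = discrepancy y h \<phi> - discrepancy y g \<phi>"
    using pairing_diff[OF conj \<phi>_Lq g h] by (simp add: discrepancy_def)
  finally have "Lp_norm p (\<lambda>t. g t - h t) \<le> 2 * T + \<gamma>"
    using disc[OF order_trans[OF selected crit]] disc[OF crit] by linarith
  moreover have "Lp_norm p (\<lambda>t. h t - f t) \<le> ?e + Lp_norm p (\<lambda>t. g t - h t)"
    using Lp_triangle[OF conj(1) f g h] by (simp add: Lp_norm_commute[of p h f])
  ultimately show ?thesis by (simp add: T_def algebra_simps)
qed

section \<open>The noise quantile\<close>

lemma pairing_self_neq_0:
  assumes \<psi>: "\<psi> \<in> Lp_space 2" and nz: "\<not> (AE t in cube_measure. \<psi> t = 0)"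
  shows "pairing \<psi> \<psi> \<noteq> 0"
proof
  assume "pairing \<psi> \<psi> = 0"
  then have "Lp_norm 2 \<psi> = 0"
    using Lp_norm_finite[of 2 \<psi>] by (simp add: pairing_def power2_eq_square)
  moreover have "0 < Lp_norm 2 \<psi>"
    by (rule Lp_norm_pos[OF _ \<psi> nz]) simp
  ultimately show False by simp
qed

lemma white_noise_gaussian:
  assumes "white_noise M Z" "\<psi> \<in> Lp_space 2"
  shows "Z \<psi> \<in> borel_measurable M" and "gaussian_rv M (Z \<psi>)"
proof -
  have "gaussian_rv M (\<lambda>\<omega>. \<Sum>t\<in>{\<psi>}. 1 * Z t \<omega>)"
    using assms unfolding white_noise_def gaussian_process_def
    by (elim conjE allE[of _ "{\<psi>}"] allE[of _ "\<lambda>_. 1"]) simp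
  then show "gaussian_rv M (Z \<psi>)" by simp
  then show "Z \<psi> \<in> borel_measurable M" by (simp add: gaussian_rv_def)
qed

text \<open>A constant value would be 0 since \<open>Z \<psi>\<close> is centred, and this contradicts that its second
  moment \<open>\<integral>\<psi>\<^sup>2\<close> is nonzero. The other kind of Gaussian variable has a density.\<close>

lemma (in prob_space) white_noise_no_atoms:
  assumes Z: "white_noise M Z" and \<psi>: "\<psi> \<in> Lp_space 2"
    and nz: "\<not> (AE t in cube_measure. \<psi> t = 0)"
  shows "AE \<omega> in M. Z \<psi> \<omega> \<noteq> c"
proof -
  have [measurable]: "Z \<psi> \<in> borel_measurable M" by (rule white_noise_gaussian[OF Z \<psi>])
  have nondegenerate: "\<not> (AE \<omega> in M. Z \<psi> \<omega> = \<mu>)" for \<mu>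
  proof
    assume const: "AE \<omega> in M. Z \<psi> \<omega> = \<mu>"
    have "(LINT \<omega>|M. Z \<psi> \<omega>) = (LINT \<omega>|M. \<mu>)"
      by (rule integral_cong_AE) (use const in auto)
    then have "\<mu> = 0" using Z \<psi> by (simp add: white_noise_def prob_space)
    have "(LINT \<omega>|M. Z \<psi> \<omega> * Z \<psi> \<omega>) = (LINT \<omega>|M. 0)"
      by (rule integral_cong_AE) (use const \<open>\<mu> = 0\<close> in auto)
    then have "pairing \<psi> \<psi> = 0" using Z \<psi> by (simp add: white_noise_def)
    with pairing_self_neq_0[OF \<psi> nz] show False by simp
  qed
  then obtain \<mu> \<sigma> where "0 < \<sigma>" "distributed M lborel (Z \<psi>) (normal_density \<mu> \<sigma>)"
    using white_noise_gaussian(2)[OF Z \<psi>] by (auto simp: gaussian_rv_def)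
  then have "emeasure M (Z \<psi> -` {c} \<inter> space M) =
      (\<integral>\<^sup>+x. ennreal (normal_density \<mu> \<sigma> x) * indicator {c} x \<partial>lborel)"
    by (intro distributed_emeasure) auto
  also have "\<dots> = 0"
  proof (subst nn_integral_0_iff_AE)
    show "AE x in lborel. ennreal (normal_density \<mu> \<sigma> x) * indicator {c} x = 0"
      using AE_lborel_singleton[of c] by eventually_elim simp
  qed simp
  finally show ?thesis
    by (intro AE_I[of _ _ "Z \<psi> -` {c} \<inter> space M"]) auto
qed

text \<open>A least real number with a given property need not exist. Here, without atoms, the tail
  probability is 1 minus the distribution function, which is continuous, so the admissible
  thresholds form a closed set. The set is nonempty because the tail vanishes at infinity. It is
  bounded below by 0, and 0 itself is excluded because the tail there is \<open>1 > \<delta>\<close>. Hence it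
  contains its infimum.\<close>

lemma (in prob_space) Least_quantile_attained:
  fixes X :: "'a \<Rightarrow> real"
  assumes X[measurable]: "random_variable borel X"
    and nonneg: "AE \<omega> in M. 0 \<le> X \<omega>" and no_atoms: "\<And>c. AE \<omega> in M. X \<omega> \<noteq> c"
    and \<delta>: "0 < \<delta>" "\<delta> < 1"
  defines "k \<equiv> (LEAST k. 0 < k \<and> prob {\<omega> \<in> space M. k \<le> X \<omega>} \<le> \<delta>)"
  shows "0 < k" and "prob {\<omega> \<in> space M. k \<le> X \<omega>} \<le> \<delta>"
proof -
  interpret D: real_distribution "distr M borel X"
    by (intro real_distribution_distr) simp
  let ?G = "cdf (distr M borel X)"
  have G: "?G c = prob {\<omega> \<in> space M. X \<omega> \<le> c}" for c
    by (simp add: cdf_def measure_distr vimage_def Int_def conj_commute)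
  have tail: "prob {\<omega> \<in> space M. c \<le> X \<omega>} = 1 - ?G c" for c
  proof -
    have "prob {\<omega> \<in> space M. c \<le> X \<omega>} = prob {\<omega> \<in> space M. \<not> X \<omega> \<le> c}"
      using no_atoms[of c] by (intro finite_measure_eq_AE) auto
    also have "\<dots> = 1 - ?G c" unfolding G by (rule prob_neg) measurable
    finally show ?thesis .
  qed
  have "continuous_on UNIV ?G"
  proof (rule continuous_at_imp_continuous_on, intro ballI)
    fix c
    have "measure (distr M borel X) {c} = prob {\<omega> \<in> space M. X \<omega> = c}"
      by (simp add: measure_distr vimage_def Int_def conj_commute)
    also have "\<dots> = 0" using no_atoms[of c] by (subst prob_eq_0) auto
    finally show "isCont ?G c" by (simp add: D.isCont_cdf)
  qed
  then have "closed {c. 1 - \<delta> \<le> ?G c}"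
    by (intro closed_Collect_le) auto
  moreover have "\<forall>\<^sub>F c in at_top. 1 - \<delta> < ?G c"
    using order_tendstoD(1)[OF D.cdf_lim_at_top_prob, of "1 - \<delta>"] \<delta> by simp
  then obtain c0 where "1 - \<delta> \<le> ?G c0"
    by (auto simp: eventually_at_top_linorder intro: less_imp_le)
  then have "{c. 1 - \<delta> \<le> ?G c} \<noteq> {}" by auto
  moreover have pos: "0 < c" if "1 - \<delta> \<le> ?G c" for c
  proof (rule ccontr)
    assume "\<not> 0 < c"
    then have "AE \<omega> in M. c < X \<omega>"
      by (intro eventually_elim2[OF nonneg no_atoms[of c]]) auto
    then have "?G c = 0"
      unfolding G by (subst prob_eq_0) (auto simp: not_le)
    with that \<delta> show False by simp
  qed
  then have "bdd_below {c. 1 - \<delta> \<le> ?G c}" by (intro bdd_belowI[of _ 0]) (auto intro: less_imp_le)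
  ultimately have Inf: "Inf {c. 1 - \<delta> \<le> ?G c} \<in> {c. 1 - \<delta> \<le> ?G c}"
    by (intro closed_contains_Inf)
  have eq: "0 < c \<and> prob {\<omega> \<in> space M. c \<le> X \<omega>} \<le> \<delta> \<longleftrightarrow> 1 - \<delta> \<le> ?G c" for c
    using pos[of c] by (auto simp: tail)
  have "k = Inf {c. 1 - \<delta> \<le> ?G c}"
    unfolding k_def eq
    using Inf \<open>bdd_below _\<close> by (intro Least_equality) (auto intro: cInf_lower)
  then show "0 < k" and "prob {\<omega> \<in> space M. k \<le> X \<omega>} \<le> \<delta>"
    using Inf eq[of k] by auto
qed

text \<open>The maximum takes a value \<open>c\<close> only if \<open>Z \<phi>\<close> is \<open>c \<parallel>\<phi>\<parallel>\<^sub>2\<close> or \<open>- c \<parallel>\<phi>\<parallel>\<^sub>2\<close> for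
  one of the finitely many \<open>\<phi>\<close>, so it has no atoms either.\<close>

lemma (in prob_space) noise_quantile_attained:
  assumes Z: "white_noise M Z" and \<Psi>: "finite \<Psi>" "\<Psi> \<noteq> {}" "\<Psi> \<subseteq> Lp_space 2"
    and nz: "\<And>\<phi>. \<phi> \<in> \<Psi> \<Longrightarrow> \<not> (AE t in cube_measure. \<phi> t = 0)"
    and \<delta>: "0 < \<delta>" "\<delta> < 1"
  defines "\<kappa> \<equiv> noise_quantile M Z \<delta> \<Psi>"
    and "X \<equiv> \<lambda>\<omega>. MAX \<phi>\<in>\<Psi>. \<bar>Z \<phi> \<omega>\<bar> / Lp_norm 2 \<phi>"
  shows "random_variable borel X"
    and "0 < \<kappa>" and "prob {\<omega> \<in> space M. \<kappa> \<le> X \<omega>} \<le> \<delta>"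
proof -
  show X: "random_variable borel X"
    unfolding X_def using white_noise_gaussian(1)[OF Z] \<Psi> by (intro borel_measurable_Max) auto
  have norm_pos: "0 < Lp_norm 2 \<phi>" if "\<phi> \<in> \<Psi>" for \<phi>
    using that \<Psi>(3) nz by (intro Lp_norm_pos) auto
  have nonneg: "0 \<le> X \<omega>" for \<omega>
    using \<Psi>(1,2) unfolding X_def by (subst Max_ge_iff) (auto intro!: divide_nonneg_nonneg Lp_norm_nonneg)
  have no_atoms: "AE \<omega> in M. X \<omega> \<noteq> c" for c
  proof -
    have "AE \<omega> in M. \<forall>\<phi>\<in>\<Psi>. Z \<phi> \<omega> \<noteq> c * Lp_norm 2 \<phi> \<and> Z \<phi> \<omega> \<noteq> - (c * Lp_norm 2 \<phi>)"
      using \<Psi> nz by (intro AE_finite_allI AE_conjI white_noise_no_atoms[OF Z]) auto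
    then show ?thesis
    proof eventually_elim
      case (elim \<omega>)
      have "X \<omega> \<in> (\<lambda>\<phi>. \<bar>Z \<phi> \<omega>\<bar> / Lp_norm 2 \<phi>) ` \<Psi>"
        unfolding X_def using \<Psi>(1,2) by (intro Max_in) auto
      then obtain \<phi> where "\<phi> \<in> \<Psi>" "X \<omega> = \<bar>Z \<phi> \<omega>\<bar> / Lp_norm 2 \<phi>" by auto
      with elim norm_pos[of \<phi>] show "X \<omega> \<noteq> c"
        by (auto simp: field_simps abs_if split: if_splits)
    qed
  qed
  have "\<kappa> = (LEAST k. 0 < k \<and> prob {\<omega> \<in> space M. k \<le> X \<omega>} \<le> \<delta>)"
    by (simp add: \<kappa>_def noise_quantile_def X_def)
  then show "0 < \<kappa>" and "prob {\<omega> \<in> space M. \<kappa> \<le> X \<omega>} \<le> \<delta>"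
    using Least_quantile_attained[OF X _ no_atoms \<delta>] nonneg by auto
qed

section \<open>The risk bound\<close>

lemma (in prob_space) expectation_le_off_bad_event:
  assumes [measurable]: "random_variable borel X" and E[measurable]: "E \<in> events"
    and X: "\<And>\<omega>. \<omega> \<in> space M \<Longrightarrow> 0 \<le> X \<omega> \<and> X \<omega> \<le> C"
    and good: "\<And>\<omega>. \<omega> \<in> space M - E \<Longrightarrow> X \<omega> \<le> B"
    and "0 \<le> B" "prob E \<le> \<delta>"
  shows "expectation X \<le> B + C * \<delta>"
proof -
  have "0 \<le> C" using X not_empty by (meson equals0I order_trans)
  have "integrable M X"
    by (rule integrable_const_bound[of _ C]) (use X in auto)
  then have "expectation X \<le> expectation (\<lambda>\<omega>. B + C * indicator E \<omega>)"
  proof (rule integral_mono)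
    fix \<omega> assume "\<omega> \<in> space M"
    then show "X \<omega> \<le> B + C * indicator E \<omega>"
      using X[of \<omega>] good[of \<omega>] \<open>0 \<le> B\<close> by (cases "\<omega> \<in> E") auto
  qed (use E in \<open>auto simp: emeasure_eq_measure\<close>)
  also have "\<dots> = B + C * prob E"
    using E by (simp add: prob_space emeasure_eq_measure)
  also have "\<dots> \<le> B + C * \<delta>" using \<open>0 \<le> C\<close> assms by (simp add: mult_left_mono)
  finally show ?thesis .
qed

theorem theorem1:
  fixes M :: "'w measure"
    and Z :: "('d::finite) func \<Rightarrow> 'w \<Rightarrow> real"
    and f :: "'d func"
    and F :: "nat \<Rightarrow> 'd func"
    and \<psi> :: "nat \<Rightarrow> nat \<Rightarrow> 'd func"
    and N istar :: nat
    and ihat :: "'w \<Rightarrow> nat"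
    and p q :: ennreal
    and \<epsilon> \<gamma> \<delta> \<kappa> :: real
    and \<Psi> \<Psi>star :: "'d func set"
  assumes "prob_space M"
    and "white_noise M Z"
    and "0 < \<epsilon>" "\<epsilon> < 1"
    and "1 \<le> p" "inverse p + inverse q = 1"
    and "0 \<le> \<gamma>"
    and "0 < \<delta>" "\<delta> < 1"
    and "2 \<le> N"
    and "f \<in> Lp_space p"
    and "\<And>i. i \<in> {1..N} \<Longrightarrow> F i \<in> Lp_space p"
    and "inj_on (\<lambda>i. restrict (F i) unit_cube) {1..N}"
    and "\<And>i j. i \<in> {1..N} \<Longrightarrow> j \<in> {1..N} \<Longrightarrow> i \<noteq> j \<Longrightarrow>
           \<psi> i j \<in> Lp_space 2 \<inter> Lp_space q \<and> \<not> (AE t in cube_measure. \<psi> i j t = 0)"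
    and "\<Psi> = {\<psi> i j | i j. i \<in> {1..N} \<and> j \<in> {1..N} \<and> i \<noteq> j}"
    and "good_set \<gamma> p \<Psi> {\<lambda>t. F i t - F j t | i j. i \<in> {1..N} \<and> j \<in> {1..N} \<and> i \<noteq> j}"
    and "\<And>i j. i \<in> {1..N} \<Longrightarrow> j \<in> {1..N} \<Longrightarrow> i \<noteq> j \<Longrightarrow>
           representer \<gamma> p (\<lambda>t. F i t - F j t) (\<psi> i j)"
    and "is_arg_min (\<lambda>i. Lp_norm p (\<lambda>t. f t - F i t)) (\<lambda>i. i \<in> {1..N}) istar"
    and "\<Psi>star = {\<psi> istar i | i. i \<in> {1..N} \<and> i \<noteq> istar}"
    and "\<kappa> = noise_quantile M Z \<delta> \<Psi>"
    and "ihat \<in> measurable M (count_space UNIV)"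
    and "\<And>\<omega>. \<omega> \<in> space M \<Longrightarrow>
           is_arg_min (\<lambda>i. criterion \<epsilon> \<kappa> q \<Psi> (\<lambda>\<phi>. observation \<epsilon> f Z \<phi> \<omega>) (F i))
             (\<lambda>i. i \<in> {1..N}) (ihat \<omega>)"
  shows "risk M p (\<lambda>\<omega>. F (ihat \<omega>)) f \<le>
           (2 * (MAX \<phi>\<in>\<Psi>star. Lp_norm q \<phi>) + 1) * (MIN i\<in>{1..N}. Lp_norm p (\<lambda>t. f t - F i t))
           + 2 * \<kappa> * \<epsilon> * (MAX \<phi>\<in>\<Psi>star. Lp_norm 2 \<phi>)
           + \<gamma>
           + (Lp_norm p f + (MAX i\<in>{1..N}. Lp_norm p (F i))) * \<delta>"
proof -
  interpret prob_space M by fact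
  note Z = assms(2) and conj = assms(5,6) and f = assms(11) and F = assms(12)
    and probe = assms(14) and \<Psi>_def = assms(15) and repr = assms(17)
    and istar = assms(18) and \<Psi>star_def = assms(19) and ihat = assms(22)
  have q: "1 \<le> q"
    using conj by (cases rule: conjugate_exponent_cases) auto
  have istar_in: "istar \<in> {1..N}" and ihat_in: "\<omega> \<in> space M \<Longrightarrow> ihat \<omega> \<in> {1..N}" for \<omega>
    using istar ihat[of \<omega>] by (auto simp: is_arg_min_def)
  have fin: "finite \<Psi>"
    by (rule finite_subset[of _ "(\<lambda>(i, j). \<psi> i j) ` ({1..N} \<times> {1..N})"]) (auto simp: \<Psi>_def)
  have fin_star: "finite \<Psi>star" unfolding \<Psi>star_def by simp
  obtain j where "j \<in> {1..N}" "j \<noteq> istar"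
    using that[of "if istar = 1 then 2 else 1"] \<open>2 \<le> N\<close> by simp
  then have star_ne: "\<Psi>star \<noteq> {}" by (auto simp: \<Psi>star_def)
  have "\<Psi>star \<subseteq> \<Psi>" using istar_in by (auto simp: \<Psi>_def \<Psi>star_def)
  with star_ne have ne: "\<Psi> \<noteq> {}" by auto
  have \<Psi>_probe: "\<phi> \<in> Lp_space 2 \<inter> Lp_space q \<and> \<not> (AE t in cube_measure. \<phi> t = 0)"
    if "\<phi> \<in> \<Psi>" for \<phi>
    using that probe unfolding \<Psi>_def by blast
  then have L2: "\<Psi> \<subseteq> Lp_space 2" and Lq: "\<Psi> \<subseteq> Lp_space q"
    and nz: "\<phi> \<in> \<Psi> \<Longrightarrow> \<not> (AE t in cube_measure. \<phi> t = 0)" for \<phi>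
    by blast+
  have q_pos: "0 < Lp_norm q \<phi>" and two_pos: "0 < Lp_norm 2 \<phi>" if "\<phi> \<in> \<Psi>" for \<phi>
    using \<Psi>_probe[OF that] Lp_norm_pos[OF q, of \<phi>] Lp_norm_pos[of 2 \<phi>] by simp_all
  define X where "X \<omega> = (MAX \<phi>\<in>\<Psi>. \<bar>Z \<phi> \<omega>\<bar> / Lp_norm 2 \<phi>)" for \<omega>
  define E where "E = {\<omega> \<in> space M. \<kappa> \<le> X \<omega>}"
  have [measurable]: "random_variable borel X" and \<kappa>: "0 < \<kappa>" and E: "prob E \<le> \<delta>"
    using noise_quantile_attained[OF Z fin ne L2 nz \<open>0 < \<delta>\<close> \<open>\<delta> < 1\<close>]
    by (simp_all add: X_def[abs_def] E_def \<open>\<kappa> = _\<close>)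
  define a where "a = (MAX \<phi>\<in>\<Psi>star. Lp_norm q \<phi>)"
  define b where "b = (MAX \<phi>\<in>\<Psi>star. Lp_norm 2 \<phi>)"
  define m where "m = Lp_norm p (\<lambda>t. f t - F istar t)"
  have a: "Lp_norm q \<phi> \<le> a" and b: "Lp_norm 2 \<phi> \<le> b" if "\<phi> \<in> \<Psi>star" for \<phi>
    using that fin_star by (auto simp: a_def b_def)
  obtain \<phi>0 where "\<phi>0 \<in> \<Psi>star" using star_ne by auto
  then have nonneg: "0 \<le> a" "0 \<le> b" "0 \<le> m"
    using order_trans[OF Lp_norm_nonneg a[of \<phi>0]] order_trans[OF Lp_norm_nonneg b[of \<phi>0]]
    by (simp_all add: m_def Lp_norm_nonneg)
  have m: "(MIN i\<in>{1..N}. Lp_norm p (\<lambda>t. f t - F i t)) = m"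
    using istar unfolding m_def
    by (intro Min_eqI) (auto simp: is_arg_min_linorder)
  have off_E: "Lp_norm p (\<lambda>t. F (ihat \<omega>) t - f t) \<le> (2 * a + 1) * m + 2 * \<kappa> * \<epsilon> * b + \<gamma>"
    if \<omega>: "\<omega> \<in> space M - E" for \<omega>
  proof (cases "ihat \<omega> = istar")
    \<comment> \<open>There is no probe for the pair of equal indices; the loss is then the minimum \<open>m\<close> itself.\<close>
    case True
    have "0 \<le> 2 * (a * m) + 2 * (\<kappa> * \<epsilon> * b) + \<gamma>"
      using nonneg \<kappa> \<open>0 < \<epsilon>\<close> \<open>0 \<le> \<gamma>\<close> by simp
    then show ?thesis
      using Lp_norm_commute[of p "F istar" f] by (simp add: True m_def[symmetric] algebra_simps)
  next
    case False
    let ?\<phi> = "\<psi> istar (ihat \<omega>)"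
    have \<omega>': "\<omega> \<in> space M" using \<omega> by simp
    have star: "?\<phi> \<in> \<Psi>star" using False ihat_in[OF \<omega>'] by (auto simp: \<Psi>star_def)
    with \<open>\<Psi>star \<subseteq> \<Psi>\<close> have \<phi>: "?\<phi> \<in> \<Psi>" by auto
    have noise: "\<bar>observation \<epsilon> f Z \<phi> \<omega> - pairing \<phi> f\<bar> \<le> \<epsilon> * \<kappa> * Lp_norm 2 \<phi>"
      if "\<phi> \<in> \<Psi>" for \<phi>
    proof -
      have "\<bar>Z \<phi> \<omega>\<bar> / Lp_norm 2 \<phi> \<le> X \<omega>" using that fin by (simp add: X_def)
      also have "X \<omega> \<le> \<kappa>" using \<omega> by (auto simp: E_def)
      finally have "\<bar>Z \<phi> \<omega>\<bar> \<le> \<kappa> * Lp_norm 2 \<phi>"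
        using two_pos[OF that] by (simp add: field_simps)
      then show ?thesis
        using \<open>0 < \<epsilon>\<close> by (simp add: observation_def abs_mult mult.assoc)
    qed
    have "Lp_norm p (\<lambda>t. F (ihat \<omega>) t - f t) \<le>
        (2 * Lp_norm q ?\<phi> + 1) * m + 2 * \<kappa> * \<epsilon> * Lp_norm 2 ?\<phi> + \<gamma>"
      unfolding m_def
    proof (rule selection_error_bound[OF conj fin Lq q_pos f F F noise])
      show "criterion \<epsilon> \<kappa> q \<Psi> (\<lambda>\<phi>. observation \<epsilon> f Z \<phi> \<omega>) (F (ihat \<omega>)) \<le>
          criterion \<epsilon> \<kappa> q \<Psi> (\<lambda>\<phi>. observation \<epsilon> f Z \<phi> \<omega>) (F istar)"
        using ihat[OF \<omega>'] istar_in by (auto simp: is_arg_min_linorder)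
      show "representer \<gamma> p (\<lambda>t. F istar t - F (ihat \<omega>) t) ?\<phi>"
        using False by (intro repr istar_in ihat_in \<omega>') simp
    qed (use \<phi> istar_in ihat_in \<omega>' in auto)
    also have "\<dots> \<le> (2 * a + 1) * m + 2 * \<kappa> * \<epsilon> * b + \<gamma>"
      using a[OF star] b[OF star] nonneg \<kappa> \<open>0 < \<epsilon>\<close>
      by (intro add_mono mult_right_mono mult_left_mono) auto
    finally show ?thesis .
  qed
  have crude: "Lp_norm p (\<lambda>t. F (ihat \<omega>) t - f t) \<le> Lp_norm p f + (MAX i\<in>{1..N}. Lp_norm p (F i))"
    if "\<omega> \<in> space M" for \<omega>
  proof -
    have "Lp_norm p (\<lambda>t. F (ihat \<omega>) t - f t) \<le> Lp_norm p (F (ihat \<omega>)) + Lp_norm p f"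
      by (rule Lp_diff(2)[OF conj(1) F[OF ihat_in[OF that]] f])
    moreover have "Lp_norm p (F (ihat \<omega>)) \<le> (MAX i\<in>{1..N}. Lp_norm p (F i))"
      using ihat_in[OF that] by (intro Max_ge) auto
    ultimately show ?thesis by linarith
  qed
  have "risk M p (\<lambda>\<omega>. F (ihat \<omega>)) f \<le> ((2 * a + 1) * m + 2 * \<kappa> * \<epsilon> * b + \<gamma>)
      + (Lp_norm p f + (MAX i\<in>{1..N}. Lp_norm p (F i))) * \<delta>"
    unfolding risk_def
  proof (rule expectation_le_off_bad_event[where E = E])
    show "random_variable borel (\<lambda>\<omega>. Lp_norm p (\<lambda>t. F (ihat \<omega>) t - f t))"
      by (rule measurable_compose[OF \<open>ihat \<in> _\<close>]) simp
    show "E \<in> events" unfolding E_def by measurable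
    show "0 \<le> (2 * a + 1) * m + 2 * \<kappa> * \<epsilon> * b + \<gamma>"
      using nonneg \<kappa> \<open>0 < \<epsilon>\<close> \<open>0 \<le> \<gamma>\<close> by simp
  qed (use off_E crude E Lp_norm_nonneg in auto)
  then show ?thesis unfolding m a_def[symmetric] b_def[symmetric] by simp
qed

end
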